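(* Let $d \ge 1$ and $n > d$ be integers, let $0 < \alpha, \epsilon < 1$, and let $P_1, \dots, P_n$ be convex sets in $\mathbb{R}^d$, where the description complexity of each set depends only on $d$ (and not on $n$). Consider the following randomized tester with parameter $t$: for $i = 1, 2, \dots, t$, pick a $(d+1)$-tuple $P_{i_1}, \dots, P_{i_{d+1}}$ uniformly at random among all $\binom{n}{d+1}$ such tuples; if $\bigcap_{j=1}^{d+1} P_{i_j} = \emptyset$, return FAIL. If no round returned FAIL, return PASS. With $t = \log_\alpha \epsilon$: (i) if $\bigcap_{i=1}^n P_i \neq \emptyset$, the tester returns PASS; (ii) if every collection of $\frac{\alpha}{d+1} n$ of the sets $P_1,\dots,P_n$ has empty intersection (i.e. no point of $\mathbb{R}^d$ belongs to $\frac{\alpha}{d+1} n$ of the sets), the tester returns FAIL with probability at least $1 - \epsilon$; (iii) the running time of the tester does not depend on $n$.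
   Context: A "$q$-tuple" is an unordered collection of $q$ of the sets $P_{i_1}, \dots, P_{i_q}$ with distinct indices (the order of elements is not important). The running time is measured assuming that each set has complexity depending only on $d$, so that testing whether the intersection of $d+1$ of the sets is empty takes time bounded by some function $f(d)$ of $d$ alone. *)

theory Defs
  imports "HOL-Probability.Probability"
begin

datatype verdict = PASS | FAIL

text \<open>A \<open>q\<close>-tuple is represented by its set of \<open>q\<close> distinct indices from \<open>{1..n}\<close>, so that
  sets of the family that coincide but have different indices still count separately.\<close>

definition tuples :: "nat \<Rightarrow> nat \<Rightarrow> nat set set" where
  "tuples n q = {I. I \<subseteq> {1..n} \<and> card I = q}"

text \<open>
  The input is a family \<open>D\<close> of descriptions, indexed by \<open>{1..n}\<close>; the description \<open>D i\<close> denotes the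
  set \<open>region (D i)\<close> in $\mathbb{R}^d$, where \<open>d = CARD('d)\<close>. An emptiness test applied to a
  multiset \<open>Q\<close> of descriptions takes time \<open>test_time Q\<close>. The tester returns its verdict together
  with the running time of that run: in every round, \<open>d + 1\<close> units for picking the \<open>d + 1\<close>
  indices, the time of the emptiness test, and one unit for the branch; plus one unit for the
  final return.
\<close>

primrec tester ::
  "('r \<Rightarrow> (real ^ 'd) set) \<Rightarrow> ('r multiset \<Rightarrow> nat) \<Rightarrow> nat \<Rightarrow> (nat \<Rightarrow> 'r) \<Rightarrow> nat
    \<Rightarrow> (verdict \<times> nat) pmf" where
  "tester region test_time n D 0 = return_pmf (PASS, 1)"
| "tester region test_time n D (Suc t) =
    bind_pmf (pmf_of_set (tuples n (CARD('d) + 1))) (\<lambda>I.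
      let c = (CARD('d) + 1) + test_time (image_mset D (mset_set I)) + 1 in
      if (\<Inter>i\<in>I. region (D i)) = {} then return_pmf (FAIL, c)
      else map_pmf (\<lambda>(v, c'). (v, c + c')) (tester region test_time n D t))"

text \<open>The number of rounds is \<open>log\<^sub>\<alpha> \<epsilon>\<close> rounded up to an integer.\<close>

definition rounds :: "real \<Rightarrow> real \<Rightarrow> nat" where
  "rounds \<alpha> \<epsilon> = nat \<lceil>log \<alpha> \<epsilon>\<rceil>"

end

theory Submission imports Defs begin

text \<open>A round passes exactly when the chosen tuple intersects, so the heart of the matter is the
  fractional Helly theorem: if a fraction \<open>\<alpha>\<close> of the \<open>(d+1)\<close>-tuples intersect, some point
  lies in \<open>\<alpha> n / (d+1)\<close> of the sets. After shrinking the sets to compact ones, Helly's theorem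
  shows that the point of least norm of the intersection of a \<open>(d+1)\<close>-tuple is already the point
  of least norm for some \<open>d\<close> of its members. Some \<open>d\<close>-tuple therefore serves an average share of
  the intersecting \<open>(d+1)\<close>-tuples, and its least-norm point lies in all the sets that occur.\<close>

section \<open>The fractional Helly theorem\<close>

text \<open>If the conclusion failed, any \<open>DIM('a) + 1\<close> of the
  \<open>DIM('a) + 2\<close> convex sets \<open>C i\<close> and \<open>L\<close> would meet, and
  Helly's theorem would give a point common to all of them.\<close>

lemma Helly_drop_one:
  fixes C :: "'i \<Rightarrow> 'a::euclidean_space set"
  assumes "card I = DIM('a) + 1" and "\<And>i. i \<in> I \<Longrightarrow> convex (C i)" and "convex L"
    and nonempty: "(\<Inter>i\<in>I. C i) \<noteq> {}" and disjoint: "(\<Inter>i\<in>I. C i) \<inter> L = {}"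
  shows "\<exists>i\<in>I. (\<Inter>j\<in>I - {i}. C j) \<inter> L = {}"
proof (rule ccontr)
  assume "\<not> ?thesis"
  then have meet: "(\<Inter>j\<in>I - {i}. C j) \<inter> L \<noteq> {}" if "i \<in> I" for i
    using that by blast
  have fin: "finite I" and "I \<noteq> {}"
    using assms(1) by (auto intro: card_ge_0_finite)
  \<comment> \<open>\<open>Helly\<close> counts a set of sets, so coinciding members must be
    excluded: if \<open>C i = C j\<close>, leaving out \<open>i\<close> would not change the
    intersection, which misses \<open>L\<close>.\<close>
  have inj: "inj_on C I"
  proof (rule inj_onI, rule ccontr)
    fix i j assume ij: "i \<in> I" "j \<in> I" "C i = C j" "i \<noteq> j"
    then have "(\<Inter>k\<in>I - {i}. C k) \<subseteq> (\<Inter>k\<in>I. C k)" by blast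
    then show False using meet[OF ij(1)] disjoint by blast
  qed
  have new: "L \<notin> C ` I"
    using nonempty disjoint by blast
  have "\<Inter>(insert L (C ` I)) \<noteq> {}"
  proof (rule Helly)
    show "DIM('a) + 1 \<le> card (insert L (C ` I))"
      using fin new assms(1) by (simp add: card_image[OF inj])
    show "\<forall>s\<in>insert L (C ` I). convex s" using assms by auto
    fix t assume t: "t \<subseteq> insert L (C ` I)" "card t = DIM('a) + 1"
    have "card (insert L (C ` I)) = DIM('a) + 2"
      using fin new assms(1) by (simp add: card_image[OF inj])
    then have "card (insert L (C ` I)) > card t" using t by simp
    \<comment> \<open>\<open>x\<close> is a set left out of \<open>t\<close>. Without
      \<open>L\<close>, the members of \<open>t\<close> meet by \<open>nonempty\<close>; without
      some \<open>C i\<close>, they meet by \<open>meet\<close>.\<close>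
    then obtain x where x: "x \<in> insert L (C ` I)" "x \<notin> t"
      using t(1) by (metis less_irrefl subsetI subset_antisym)
    show "\<Inter>t \<noteq> {}"
    proof (cases "x = L")
      case True
      then have "t \<subseteq> C ` I" using t x by auto
      then show ?thesis using nonempty by blast
    next
      case False
      then obtain i where i: "i \<in> I" "x = C i" using x by auto
      then have "t \<subseteq> insert L (C ` (I - {i}))" using t x by blast
      then show ?thesis using meet[OF i(1)] by blast
    qed
  qed
  then show False using disjoint by auto
qed

text \<open>The open ball around \<open>a\<close> that reaches just up to the closest point is
  convex and misses the intersection, so it can play the role of \<open>L\<close> in
  \<open>Helly_drop_one\<close>.\<close>

lemma closest_point_drop_one:
  fixes C :: "'i \<Rightarrow> 'a::euclidean_space set"
  assumes "card I = DIM('a) + 1" and "\<And>i. i \<in> I \<Longrightarrow> convex (C i) \<and> closed (C i)"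
    and nonempty: "(\<Inter>i\<in>I. C i) \<noteq> {}"
  shows "\<exists>i\<in>I. closest_point (\<Inter>j\<in>I - {i}. C j) a = closest_point (\<Inter>j\<in>I. C j) a"
proof -
  let ?x = "closest_point (\<Inter>j\<in>I. C j) a"
  have closed: "closed (\<Inter>j\<in>I. C j)" using assms by auto
  have x: "?x \<in> (\<Inter>j\<in>I. C j)" by (rule closest_point_in_set[OF closed nonempty])
  have "(\<Inter>i\<in>I. C i) \<inter> ball a (dist a ?x) = {}"
    using closest_point_le[OF closed, of _ a] by fastforce
  then obtain i where i: "i \<in> I" "(\<Inter>j\<in>I - {i}. C j) \<inter> ball a (dist a ?x) = {}"
    using Helly_drop_one[of I C "ball a (dist a ?x)"] assms by auto
  \<comment> \<open>Leaving out \<open>i\<close> only enlarges the intersection, so it still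
    contains \<open>?x\<close>, and the ball shows that it has no point nearer to
    \<open>a\<close>.\<close>
  have "?x = closest_point (\<Inter>j\<in>I - {i}. C j) a"
  proof (rule closest_point_unique)
    show "\<forall>z\<in>\<Inter>j\<in>I - {i}. C j. dist a ?x \<le> dist a z"
      using i(2) by (auto simp: disjoint_iff not_less)
  qed (use assms x in \<open>auto intro!: convex_INT\<close>)
  then show ?thesis using i(1) by metis
qed

text \<open>Every intersecting tuple is charged to one subset of size \<open>DIM('a)\<close>. If no
  point were deep enough, each subset would receive too few charges, and summing over all subsets
  would contradict \<open>many\<close>.\<close>

theorem fractional_Helly:
  fixes P :: "'i \<Rightarrow> 'a::euclidean_space set"
  assumes fin: "finite N" and N: "card N > DIM('a)"
    and convex: "\<And>i. i \<in> N \<Longrightarrow> convex (P i)"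
    and \<alpha>: "0 < \<alpha>" "\<alpha> \<le> 1"
    and many: "real (card {I. I \<subseteq> N \<and> card I = DIM('a) + 1 \<and> (\<Inter>i\<in>I. P i) \<noteq> {}})
        \<ge> \<alpha> * real (card N choose (DIM('a) + 1))"
  shows "\<exists>J\<subseteq>N. real (card J) \<ge> \<alpha> / real (DIM('a) + 1) * real (card N) \<and> (\<Inter>i\<in>J. P i) \<noteq> {}"
proof (rule ccontr)
  assume contra: "\<not> ?thesis"
  let ?d = "DIM('a)" and ?n = "card N"
  define G where "G = {I. I \<subseteq> N \<and> card I = ?d + 1 \<and> (\<Inter>i\<in>I. P i) \<noteq> {}}"
  have finG: "finite G" unfolding G_def using fin by simp
  have "\<forall>I\<in>G. \<exists>p. p \<in> (\<Inter>i\<in>I. P i)" unfolding G_def by blast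
  then obtain p where p: "p I \<in> (\<Inter>i\<in>I. P i)" if "I \<in> G" for I by metis
  \<comment> \<open>Hulls of finitely many chosen points are compact, lie inside the convex
    \<open>P i\<close>, and keep \<open>p I\<close> as a common point of each tuple \<open>I\<close>
    in \<open>G\<close>. Closedness is what makes closest points available.\<close>
  define C where "C i = convex hull (p ` {I\<in>G. i \<in> I})" for i
  have CP: "C i \<subseteq> P i" if "i \<in> N" for i
    unfolding C_def by (rule hull_minimal) (use that convex p in auto)
  have C: "convex (C i) \<and> closed (C i)" for i
    unfolding C_def using finG by (auto intro!: compact_imp_closed finite_imp_compact_convex_hull)
  have CI: "(\<Inter>i\<in>I. C i) \<noteq> {}" if "I \<in> G" for I
    using that unfolding C_def by (auto intro!: exI[of _ "p I"] hull_inc)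
  define q where "q S = closest_point (\<Inter>i\<in>S. C i) 0" for S
  have "\<forall>I\<in>G. \<exists>i\<in>I. q (I - {i}) = q I"
    unfolding q_def using C CI by (intro ballI closest_point_drop_one) (auto simp: G_def)
  then obtain r where r: "r I \<in> I" "q (I - {r I}) = q I" if "I \<in> G" for I by metis
  define s where "s I = I - {r I}" for I
  define T where "T = {S. S \<subseteq> N \<and> card S = ?d}"
  have cardT: "card T = ?n choose ?d" unfolding T_def by (rule n_subsets[OF fin])
  have finT: "finite T" unfolding T_def using fin by simp
  have T: "T \<noteq> {}"
  proof -
    have "card T > 0" using cardT N by simp
    then show ?thesis by auto
  qed
  have sT: "s ` G \<subseteq> T"
  proof (rule image_subsetI)
    fix I assume I: "I \<in> G"
    then have "card (s I) = ?d"
      unfolding s_def using r(1)[OF I] by (simp add: G_def)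
    then show "s I \<in> T"
      using I unfolding s_def T_def G_def by auto
  qed
  \<comment> \<open>The bound is the average load: multiplied by the number of sets in
    \<open>T\<close>, it gives exactly \<alpha> times the number of all tuples.\<close>
  have fibre: "real (card {I\<in>G. s I = S}) < \<alpha> * real (?n - ?d) / real (?d + 1)" if "S \<in> T" for S
  proof (cases "{I\<in>G. s I = S} = {}")
    case True
    have "0 < \<alpha> * real (?n - ?d) / real (?d + 1)"
      using \<alpha> N by (intro divide_pos_pos mult_pos_pos) auto
    then show ?thesis unfolding True by (simp only: card.empty of_nat_0)
  next
    case False
    let ?F = "{I\<in>G. s I = S}"
    \<comment> \<open>A tuple charged to \<open>S\<close> is determined by its removed index, so the
      fibre has as many tuples as there are indices in \<open>r\<close> followed by its image, all
      outside \<open>S\<close>.\<close>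
    have ins: "insert (r I) S = I" if "I \<in> ?F" for I
      using that r(1)[of I] unfolding s_def by blast
    have inj: "inj_on r ?F"
      by (rule inj_onI) (metis ins)
    have rS: "r ` ?F \<subseteq> N - S"
    proof (rule image_subsetI)
      fix I assume "I \<in> ?F"
      then show "r I \<in> N - S"
        using r(1)[of I] unfolding s_def G_def by blast
    qed
    have SN: "S \<subseteq> N" "card S = ?d" "finite S"
      using \<open>S \<in> T\<close> fin finite_subset unfolding T_def by auto
    \<comment> \<open>All tuples of the fibre share the closest point \<open>q S\<close>. As the
      fibre is nonempty, their union is \<open>S\<close> together with all removed indices, so
      \<open>q S\<close> is a deep point.\<close>
    have "q S \<in> C i" if i: "i \<in> S \<union> r ` ?F" for i
    proof -
      have *: "q S \<in> C j" if "I \<in> ?F" "j \<in> I" for I j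
      proof -
        have "q S = q I" using that r(2)[of I] unfolding s_def by blast
        moreover have "q I \<in> (\<Inter>i\<in>I. C i)" unfolding q_def
          by (rule closest_point_in_set) (use C CI that in auto)
        ultimately show ?thesis using that by auto
      qed
      obtain I where "I \<in> ?F" "i \<in> I"
      proof (cases "i \<in> S")
        case True
        then show ?thesis using that \<open>?F \<noteq> {}\<close> ins by blast
      next
        case False
        then show ?thesis using that i ins by blast
      qed
      then show ?thesis by (rule *)
    qed
    moreover have sub: "S \<union> r ` ?F \<subseteq> N" using SN rS by blast
    ultimately have "q S \<in> (\<Inter>i\<in>S \<union> r ` ?F. P i)" using CP by blast
    then have "real (card (S \<union> r ` ?F)) < \<alpha> / real (?d + 1) * real ?n"
      using contra sub unfolding not_le[symmetric] by blast
    moreover have "card (S \<union> r ` ?F) = ?d + card ?F"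
    proof -
      have "S \<inter> r ` ?F = {}" using rS by blast
      then show ?thesis using SN finG by (simp add: card_Un_disjoint card_image[OF inj])
    qed
    ultimately have "real ?d + real (card ?F) < \<alpha> * real ?n / real (?d + 1)"
      by simp
    \<comment> \<open>The indices in \<open>S\<close> itself account for \<open>?d\<close> of the
      sets through \<open>q S\<close>; this pays for replacing \<open>?n\<close> by
      \<open>?n - ?d\<close> in the bound.\<close>
    moreover have "\<alpha> * real ?d / real (?d + 1) \<le> real ?d"
    proof -
      have "\<alpha> * real ?d \<le> real (?d + 1) * real ?d"
        using \<alpha> by (intro mult_right_mono) auto
      then show ?thesis by (simp add: divide_le_eq algebra_simps)
    qed
    moreover have "\<alpha> * real (?n - ?d) / real (?d + 1)
        = \<alpha> * real ?n / real (?d + 1) - \<alpha> * real ?d / real (?d + 1)"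
      using N by (simp add: of_nat_diff right_diff_distrib diff_divide_distrib)
    ultimately show ?thesis by linarith
  qed
  have "real (card G) = (\<Sum>S\<in>T. real (card {I\<in>G. s I = S}))"
    using sum.group[OF finG finT sT, of "\<lambda>_. 1::real"] by simp
  also have "\<dots> < (\<Sum>S\<in>T. \<alpha> * real (?n - ?d) / real (?d + 1))"
    by (rule sum_strict_mono[OF finT T]) (rule fibre)
  also have "\<dots> = \<alpha> * (real ((?n - ?d) * (?n choose ?d)) / real (?d + 1))"
    by (simp add: cardT)
  \<comment> \<open>Both sides count pairs of a \<open>(?d + 1)\<close>-subset and a distinguished
    element of it.\<close>
  also have "(?n - ?d) * (?n choose ?d) = (?d + 1) * (?n choose (?d + 1))"
    using binomial_absorption[of ?d ?n] binomial_absorb_comp[of ?n ?d] by simp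
  also have "real \<dots> / real (?d + 1) = real (?n choose (?d + 1))"
    unfolding of_nat_mult by (rule nonzero_mult_div_cancel_left) (simp del: of_nat_add)
  finally show False using many unfolding G_def by simp
qed

section \<open>The tester\<close>

lemma finite_tuples: "finite (tuples n q)"
  unfolding tuples_def by simp

lemma card_tuples: "card (tuples n q) = n choose q"
  unfolding tuples_def by (simp add: n_subsets)

lemma tuples_nonempty: "q \<le> n \<Longrightarrow> tuples n q \<noteq> {}"
  using card_tuples[of n q] by auto

lemma tester_PASS:
  fixes region :: "'r \<Rightarrow> (real ^ 'd) set"
  assumes "n > CARD('d)" and "(\<Inter>i\<in>{1..n}. region (D i)) \<noteq> {}"
    and "(v, c) \<in> set_pmf (tester region test_time n D t)"
  shows "v = PASS"
  using assms(3)
proof (induction t arbitrary: c)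
  case (Suc t)
  have ne: "(\<Inter>i\<in>I. region (D i)) \<noteq> {}" if "I \<in> tuples n (CARD('d) + 1)" for I
    using that assms(2) unfolding tuples_def by blast
  show ?case
    using Suc ne finite_tuples[of n "CARD('d) + 1"] tuples_nonempty[of "CARD('d) + 1" n] assms(1)
    by (auto simp: Let_def)
qed simp

text \<open>A round costs at most \<open>CARD('d) + 2 + b\<close>; the extra 1 is the final return,
  paid only by runs that complete all rounds.\<close>

lemma tester_time:
  fixes region :: "'r \<Rightarrow> (real ^ 'd) set"
  assumes "n > CARD('d)"
    and "\<And>I. I \<in> tuples n (CARD('d) + 1) \<Longrightarrow> test_time (image_mset D (mset_set I)) \<le> b"
    and "(v, c) \<in> set_pmf (tester region test_time n D t)"
  shows "c \<le> 1 + t * (CARD('d) + 2 + b)"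
  using assms(3)
proof (induction t arbitrary: v c)
  case (Suc t)
  then obtain I where I: "I \<in> tuples n (CARD('d) + 1)"
    and vc: "(v, c) \<in> set_pmf (let c = (CARD('d) + 1) + test_time (image_mset D (mset_set I)) + 1 in
      if (\<Inter>i\<in>I. region (D i)) = {} then return_pmf (FAIL, c)
      else map_pmf (\<lambda>(v, c'). (v, c + c')) (tester region test_time n D t))"
    using finite_tuples[of n "CARD('d) + 1"] tuples_nonempty[of "CARD('d) + 1" n] assms(1)
    by auto
  show ?case
    using vc assms(2)[OF I] Suc.IH by (fastforce simp: Let_def split: if_splits)
qed simp

text \<open>To return \<open>PASS\<close>, a run must survive its first round, which has probability
  at most \<alpha> by \<open>few\<close>, and then an independent run with one round less.\<close>

lemma prob_tester_PASS_le:
  fixes region :: "'r \<Rightarrow> (real ^ 'd) set"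
  assumes n: "n > CARD('d)" and \<alpha>: "\<alpha> \<ge> 0"
    and few: "real (card {I \<in> tuples n (CARD('d) + 1). (\<Inter>i\<in>I. region (D i)) \<noteq> {}})
        \<le> \<alpha> * real (n choose (CARD('d) + 1))"
  shows "pmf (map_pmf fst (tester region test_time n D t)) PASS \<le> \<alpha> ^ t"
proof (induction t)
  case (Suc t)
  let ?T = "tuples n (CARD('d) + 1)"
  let ?G = "{I \<in> ?T. (\<Inter>i\<in>I. region (D i)) \<noteq> {}}"
  let ?p = "pmf (map_pmf fst (tester region test_time n D t)) PASS"
  have fin: "finite ?T" by (rule finite_tuples)
  have ne: "?T \<noteq> {}" using n by (intro tuples_nonempty) simp
  have pos: "real (n choose (CARD('d) + 1)) > 0" using n by simp
  have "map_pmf fst (tester region test_time n D (Suc t)) =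
      bind_pmf (pmf_of_set ?T) (\<lambda>I. if (\<Inter>i\<in>I. region (D i)) = {} then return_pmf FAIL
        else map_pmf fst (tester region test_time n D t))"
    by (auto simp: map_bind_pmf Let_def pmf.map_comp o_def case_prod_unfold intro!: bind_pmf_cong)
  then have "pmf (map_pmf fst (tester region test_time n D (Suc t))) PASS
      = (\<Sum>I\<in>?T. if (\<Inter>i\<in>I. region (D i)) = {} then 0 else ?p) / real (card ?T)"
    by (simp add: pmf_bind integral_pmf_of_set[OF ne fin, simplified] if_distrib[of "\<lambda>M. pmf M PASS"]
        cong: if_cong del: tester.simps)
  \<comment> \<open>Tuples with empty intersection end the run with \<open>FAIL\<close> and
    contribute nothing.\<close>
  also have "(\<Sum>I\<in>?T. if (\<Inter>i\<in>I. region (D i)) = {} then 0 else ?p) = (\<Sum>I\<in>?G. ?p)"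
    using fin by (intro sum.mono_neutral_cong_right) auto
  also have "(\<Sum>I\<in>?G. ?p) / real (card ?T) = real (card ?G) / real (n choose (CARD('d) + 1)) * ?p"
    by (simp add: card_tuples)
  also have "\<dots> \<le> \<alpha> * \<alpha> ^ t"
    using few pos \<alpha> Suc by (intro mult_mono) (auto simp: pos_divide_le_eq)
  finally show ?case by simp
qed simp

text \<open>Since the base is below 1, rounding the exponent up can only decrease the power.\<close>

lemma power_rounds_le:
  assumes "0 < \<alpha>" "\<alpha> < 1" "0 < \<epsilon>"
  shows "\<alpha> ^ rounds \<alpha> \<epsilon> \<le> \<epsilon>"
proof -
  have "\<alpha> ^ rounds \<alpha> \<epsilon> = \<alpha> powr real (rounds \<alpha> \<epsilon>)"
    using assms by (simp add: powr_realpow)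
  also have "\<dots> \<le> \<alpha> powr log \<alpha> \<epsilon>"
    using assms by (intro powr_mono') (auto simp: rounds_def intro: real_nat_ceiling_ge)
  also have "\<dots> = \<epsilon>" using assms by simp
  finally show ?thesis .
qed

text \<open>Independence of \<open>n\<close> is expressed by the order of the quantifiers: the time
  bound \<open>T\<close> is chosen before \<open>n\<close> and \<open>D\<close>.\<close>

theorem theorem1:
  fixes \<alpha> \<epsilon> :: real
    and region :: "'r \<Rightarrow> (real ^ 'd) set"
    and complexity :: "'r \<Rightarrow> nat"
    and test_time :: "'r multiset \<Rightarrow> nat"
    and g f :: "nat \<Rightarrow> nat"
  assumes "0 < \<alpha>" and "\<alpha> < 1" and "0 < \<epsilon>" and "\<epsilon> < 1"
    and test_time_bound:
      "\<And>Q. size Q = CARD('d) + 1 \<Longrightarrow> (\<forall>r\<in>#Q. complexity r \<le> g CARD('d))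
        \<Longrightarrow> test_time Q \<le> f CARD('d)"
  shows "\<exists>T :: nat. \<forall>(n :: nat) (D :: nat \<Rightarrow> 'r).
    n > CARD('d) \<longrightarrow>
    (\<forall>i\<in>{1..n}. convex (region (D i)) \<and> complexity (D i) \<le> g CARD('d)) \<longrightarrow>
    (let run = tester region test_time n D (rounds \<alpha> \<epsilon>) in
      ((\<Inter>i\<in>{1..n}. region (D i)) \<noteq> {} \<longrightarrow> (\<forall>(v, c)\<in>set_pmf run. v = PASS))
    \<and> ((\<forall>J\<subseteq>{1..n}. real (card J) \<ge> \<alpha> / real (CARD('d) + 1) * real n
            \<longrightarrow> (\<Inter>i\<in>J. region (D i)) = {})
        \<longrightarrow> measure_pmf.prob run {(v, c). v = FAIL} \<ge> 1 - \<epsilon>)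
    \<and> (\<forall>(v, c)\<in>set_pmf run. c \<le> T))"
proof (intro exI allI impI, unfold Let_def, intro conjI impI)
  fix n :: nat and D :: "nat \<Rightarrow> 'r"
  let ?run = "tester region test_time n D (rounds \<alpha> \<epsilon>)"
  assume n: "n > CARD('d)"
    and D: "\<forall>i\<in>{1..n}. convex (region (D i)) \<and> complexity (D i) \<le> g CARD('d)"
  show "\<forall>(v, c)\<in>set_pmf ?run. v = PASS" if "(\<Inter>i\<in>{1..n}. region (D i)) \<noteq> {}"
    using tester_PASS[where region = region and D = D, OF n that] by blast
  have "test_time (image_mset D (mset_set I)) \<le> f CARD('d)" if "I \<in> tuples n (CARD('d) + 1)" for I
    using that D finite_subset[of I "{1..n}"]
    by (intro test_time_bound) (auto simp: tuples_def)
  \<comment> \<open>This fixes the witness for \<open>T\<close>, which involves only the dimension,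
    \<open>f\<close> and the number of rounds.\<close>
  then show "\<forall>(v, c)\<in>set_pmf ?run. c \<le> 1 + rounds \<alpha> \<epsilon> * (CARD('d) + 2 + f CARD('d))"
    using tester_time[OF n] by blast
  assume shallow: "\<forall>J\<subseteq>{1..n}. real (card J) \<ge> \<alpha> / real (CARD('d) + 1) * real n
      \<longrightarrow> (\<Inter>i\<in>J. region (D i)) = {}"
  \<comment> \<open>By \<open>fractional_Helly\<close>, more than a fraction \<alpha> of
    intersecting tuples would produce a point that \<open>shallow\<close> forbids.\<close>
  have "real (card {I \<in> tuples n (CARD('d) + 1). (\<Inter>i\<in>I. region (D i)) \<noteq> {}})
      \<le> \<alpha> * real (n choose (CARD('d) + 1))"
  proof (rule ccontr)
    assume "\<not> ?thesis"
    then have "\<exists>J\<subseteq>{1..n}. real (card J) \<ge> \<alpha> / real (DIM(real ^ 'd) + 1) * real (card {1..n})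
        \<and> (\<Inter>i\<in>J. region (D i)) \<noteq> {}"
      using assms(1,2) n D by (intro fractional_Helly) (auto simp: tuples_def conj_assoc)
    then show False using shallow by auto
  qed
  then have "pmf (map_pmf fst ?run) PASS \<le> \<alpha> ^ rounds \<alpha> \<epsilon>"
    using n assms by (intro prob_tester_PASS_le) auto
  also have "\<dots> \<le> \<epsilon>" using assms by (intro power_rounds_le)
  finally have pass: "pmf (map_pmf fst ?run) PASS \<le> \<epsilon>" .
  have "{(v, c). v = FAIL} = - (fst -` {PASS} :: (verdict \<times> nat) set)"
    by (auto intro: verdict.exhaust)
  then have "measure_pmf.prob ?run {(v, c). v = FAIL} = 1 - pmf (map_pmf fst ?run) PASS"
    using measure_pmf.prob_compl[of "fst -` {PASS}" ?run]
    by (simp add: pmf_map Compl_eq_Diff_UNIV)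
  then show "measure_pmf.prob ?run {(v, c). v = FAIL} \<ge> 1 - \<epsilon>"
    using pass by simp
qed

end
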